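(* Let $m>1$, $k$ and $n$ be positive integers, and write $n$ in base $m$ as $n=\sum_{j\geqslant 0}c_jm^j$ with digits $c_j\in\{0,1,\ldots,m-1\}$ (with $c_j=0$ for all sufficiently large $j$). Let $\mathcal{M}=(m^{i-1})_{i\in\mathbb{N}_+}$. Then \[ p_\mathcal{M}(n,k)\equiv (c_1+1)(c_2+1)\cdots(c_{k-1}+1)\pmod{m} \] (the empty product being $1$ when $k=1$).
   Context: For a sequence $\mathcal{A}=(a_n)_{n\in\mathbb{N}_+}$ of positive integers, $k\in\mathbb{N}_+$ and $n\in\mathbb{N}$, $p_\mathcal{A}(n,k)$ is the number of tuples $(x_1,\ldots,x_k)\in\mathbb{N}^k$ with $a_1x_1+\cdots+a_kx_k=n$. Thus $p_\mathcal{M}(n,k)$ is the number of representations of $n$ as a sum of the powers $1,m,\ldots,m^{k-1}$ (restricted $m$-ary partitions), with $\sum_{n\ge0}p_\mathcal{M}(n,k)x^n=\prod_{i=0}^{k-1}(1-x^{m^i})^{-1}$. *)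

theory Defs
  imports Main "HOL-Library.FuncSet" "HOL-Number_Theory.Cong"
begin

text \<open>
  The sequence \<open>a\<close> is indexed from 1; its value at 0 is irrelevant.  A tuple
  $(x_1, \ldots, x_k)$ of natural numbers is an extensional function on \<open>{1..k}\<close>.
  If $a_1, \ldots, a_k$ are positive, the set of tuples is finite, so \<open>card\<close> is
  its true cardinality.
\<close>

definition part_count :: "(nat \<Rightarrow> nat) \<Rightarrow> nat \<Rightarrow> nat \<Rightarrow> nat" where
  "part_count a n k =
     card {x \<in> {1..k} \<rightarrow>\<^sub>E (UNIV :: nat set). (\<Sum>i=1..k. a i * x i) = n}"

definition power_seq :: "nat \<Rightarrow> nat \<Rightarrow> nat" where
  "power_seq m i = m ^ (i - 1)"

end

theory Submission
  imports Defs
begin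

text \<open>
  In a representation of \<open>n\<close> by \<open>1, m, \<dots>, m ^ k\<close> the parts larger than 1 sum to \<open>m * j\<close>
  for some \<open>j \<le> n div m\<close>, and \<open>j\<close> determines the number of ones.  So the count for
  \<open>k + 1\<close> powers is the sum of the counts of \<open>j \<le> n div m\<close> for \<open>k\<close> powers.  If \<open>k > 0\<close>,
  the latter depend on \<open>j div m\<close> only, so modulo \<open>m\<close> each full block of \<open>m\<close> consecutive
  values of \<open>j\<close> vanishes.  The last, incomplete block consists of \<open>c 1 + 1\<close> terms that are
  all equal to the count of \<open>n div m\<close>, whose digits are those of \<open>n\<close> shifted by one.
\<close>

definition part_tuples :: "(nat \<Rightarrow> nat) \<Rightarrow> nat \<Rightarrow> nat \<Rightarrow> (nat \<Rightarrow> nat) set" where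
  "part_tuples a n k = {x \<in> {1..k} \<rightarrow>\<^sub>E UNIV. (\<Sum>i=1..k. a i * x i) = n}"

lemma part_count_eq_card: "part_count a n k = card (part_tuples a n k)"
  by (simp add: part_count_def part_tuples_def)

text \<open>Each entry is bounded by \<open>n\<close>, since positive coefficients cannot shrink it.
  Finiteness is what \<open>card_SigmaI\<close> asks of the fibres later.\<close>

lemma finite_part_tuples:
  assumes "\<And>i. i \<in> {1..k} \<Longrightarrow> a i > 0"
  shows "finite (part_tuples a n k)"
proof (rule finite_subset)
  show "part_tuples a n k \<subseteq> {1..k} \<rightarrow>\<^sub>E {..n}"
  proof
    fix x assume x: "x \<in> part_tuples a n k"
    have "x i \<le> n" if i: "i \<in> {1..k}" for i
    proof -
      have "x i \<le> a i * x i" using assms[OF i] by simp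
      also have "\<dots> \<le> (\<Sum>i=1..k. a i * x i)"
        by (rule member_le_sum[OF i]) auto
      finally show ?thesis using x by (simp add: part_tuples_def)
    qed
    with x show "x \<in> {1..k} \<rightarrow>\<^sub>E {..n}"
      by (auto simp: part_tuples_def PiE_iff)
  qed
  show "finite ({1..k} \<rightarrow>\<^sub>E {..n})"
    by (intro finite_PiE) auto
qed

lemma sum_power_seq_Suc:
  "(\<Sum>i=1..Suc k. power_seq m i * x i) = x 1 + m * (\<Sum>i=1..k. power_seq m i * x (Suc i))"
proof -
  have "(\<Sum>i=1..Suc k. power_seq m i * x i)
      = x 1 + (\<Sum>i=Suc 1..Suc k. power_seq m i * x i)"
    by (subst sum.atLeast_Suc_atMost) (auto simp: power_seq_def)
  also have "(\<Sum>i=Suc 1..Suc k. power_seq m i * x i)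
      = (\<Sum>i=1..k. power_seq m (Suc i) * x (Suc i))"
    by (rule sum.shift_bounds_cl_Suc_ivl)
  \<comment> \<open>On this range \<open>i\<close> is at least 1, so the truncated exponent
    \<open>i - 1\<close> still gives m * m^(i-1) = m^i.\<close>
  also have "\<dots> = m * (\<Sum>i=1..k. power_seq m i * x (Suc i))"
    unfolding sum_distrib_left
    by (rule sum.cong) (auto simp: power_seq_def power_eq_if)
  finally show ?thesis .
qed

lemma part_count_power_seq_Suc:
  assumes "m > 0"
  shows "part_count (power_seq m) n (Suc k) = (\<Sum>j\<le>n div m. part_count (power_seq m) j k)"
proof -
  let ?T = "part_tuples (power_seq m)"
  let ?s = "\<lambda>x. \<lambda>i\<in>{1..k}. x (Suc i)"
  \<comment> \<open>\<open>?f\<close> forgets the number of ones and shifts the other multiplicities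
    down; \<open>?g\<close> recovers the number of ones as \<open>n - m * j\<close>.\<close>
  let ?f = "\<lambda>x. (\<Sum>i=1..k. power_seq m i * x (Suc i), ?s x)"
  let ?g = "\<lambda>(j, y). \<lambda>i\<in>{1..Suc k}. if i = 1 then n - m * j else y (i - 1)"
  have "bij_betw ?f (?T n (Suc k)) (SIGMA j:{..n div m}. ?T j k)"
  proof (rule bij_betw_byWitness[where f' = ?g])
    show "\<forall>x\<in>?T n (Suc k). ?g (?f x) = x"
    proof
      fix x assume "x \<in> ?T n (Suc k)"
      then have x: "x \<in> extensional {1..Suc k}"
        "x 1 + m * (\<Sum>i=1..k. power_seq m i * x (Suc i)) = n"
        unfolding part_tuples_def sum_power_seq_Suc by (auto simp: PiE_def)
      have x1: "n - m * (\<Sum>i=1..k. power_seq m i * x (Suc i)) = x 1"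
        using x(2) by simp
      show "?g (?f x) = x"
        by (rule extensionalityI[OF _ x(1)]) (auto simp: x1[simplified])
    qed
    show "\<forall>p\<in>(SIGMA j:{..n div m}. ?T j k). ?f (?g p) = p"
    proof
      fix p assume "p \<in> (SIGMA j:{..n div m}. ?T j k)"
      then obtain j y where p: "p = (j, y)" and y: "y \<in> ?T j k" by auto
      have "?s (?g (j, y)) = y"
        by (rule extensionalityI[of _ "{1..k}"]) (use y in \<open>auto simp: part_tuples_def PiE_def\<close>)
      moreover have "(\<Sum>i=1..k. power_seq m i * ?g (j, y) (Suc i)) = j"
        using y by (auto simp: part_tuples_def intro!: sum.cong)
      ultimately show "?f (?g p) = p" unfolding p by simp
    qed
    show "?f ` ?T n (Suc k) \<subseteq> (SIGMA j:{..n div m}. ?T j k)"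
    proof (rule image_subsetI)
      fix x assume "x \<in> ?T n (Suc k)"
      then have x: "x 1 + m * (\<Sum>i=1..k. power_seq m i * x (Suc i)) = n"
        unfolding part_tuples_def sum_power_seq_Suc by auto
      have "(\<Sum>i=1..k. power_seq m i * x (Suc i)) \<le> n div m"
        using x assms by (simp add: less_eq_div_iff_mult_less_eq mult.commute)
      then show "?f x \<in> (SIGMA j:{..n div m}. ?T j k)"
        by (auto simp: part_tuples_def)
    qed
    show "?g ` (SIGMA j:{..n div m}. ?T j k) \<subseteq> ?T n (Suc k)"
    proof (rule image_subsetI)
      fix p assume "p \<in> (SIGMA j:{..n div m}. ?T j k)"
      then obtain j y where p: "p = (j, y)" and j: "j \<le> n div m" and y: "y \<in> ?T j k"
        by auto
      \<comment> \<open>The bound on \<open>j\<close> makes the subtraction in \<open>?g\<close> a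
        genuine one.\<close>
      have "m * j \<le> n"
        using j assms by (simp add: less_eq_div_iff_mult_less_eq mult.commute)
      moreover have "(\<Sum>i=1..k. power_seq m i * ?g (j, y) (Suc i)) = j"
        using y by (auto simp: part_tuples_def intro!: sum.cong)
      ultimately have "(\<Sum>i=1..Suc k. power_seq m i * ?g (j, y) i) = n"
        unfolding sum_power_seq_Suc by simp
      then show "?g p \<in> ?T n (Suc k)"
        unfolding part_tuples_def p by auto
    qed
  qed
  then have "card (?T n (Suc k)) = card (SIGMA j:{..n div m}. ?T j k)"
    by (rule bij_betw_same_card)
  also have "\<dots> = (\<Sum>j\<le>n div m. card (?T j k))"
    using assms by (intro card_SigmaI) (auto intro!: finite_part_tuples simp: power_seq_def)
  finally show ?thesis by (simp add: part_count_eq_card)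
qed

lemma part_count_0: "part_count a n 0 = (if n = 0 then 1 else 0)"
  by (simp add: part_count_def)

text \<open>With no powers only 0 is representable, so the sum over \<open>j\<close> has a single
  nonzero term.\<close>

lemma part_count_power_seq_1:
  assumes "m > 0"
  shows "part_count (power_seq m) n (Suc 0) = 1"
  by (simp add: part_count_power_seq_Suc[OF assms] part_count_0)

text \<open>A full block of \<open>m\<close> equal terms is 0 modulo \<open>m\<close>; the block
  containing \<open>N\<close> has \<open>N mod m + 1\<close> terms so far.\<close>

lemma cong_sum_blocks:
  fixes f :: "nat \<Rightarrow> nat"
  assumes "m > 0"
  shows "[(\<Sum>j\<le>N. f (j div m)) = (N mod m + 1) * f (N div m)] (mod m)"
proof (induction N)
  case 0
  then show ?case by simp
next
  case (Suc N)
  have "[(\<Sum>j\<le>Suc N. f (j div m)) = (N mod m + 1) * f (N div m) + f (Suc N div m)] (mod m)"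
    using cong_add[OF Suc.IH cong_refl] by simp
  also have "[(N mod m + 1) * f (N div m) + f (Suc N div m)
      = (Suc N mod m + 1) * f (Suc N div m)] (mod m)"
  proof (cases "Suc (N mod m) = m")
    \<comment> \<open>Here \<open>N\<close> completes a block, whose coefficient is
      \<open>m\<close>, and \<open>Suc N\<close> opens a new block with one term.\<close>
    case True
    then show ?thesis
      by (simp add: mod_Suc cong_def)
  next
    case False
    then have "Suc N div m = N div m" by (simp add: div_Suc mod_Suc)
    with False show ?thesis by (simp add: mod_Suc algebra_simps)
  qed
  finally show ?case .
qed

lemma part_count_power_seq_cong:
  assumes "m > 0"
  shows "[part_count (power_seq m) n (Suc k) = (\<Prod>j=1..k. n div m ^ j mod m + 1)] (mod m)"
proof (induction k arbitrary: n)
  case 0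
  then show ?case by (simp add: part_count_power_seq_1[OF assms])
next
  case (Suc k)
  let ?P = "\<lambda>n. part_count (power_seq m) n"
  let ?f = "\<lambda>q. \<Sum>i\<le>q. ?P i k"
  \<comment> \<open>The count at \<open>j\<close> depends on \<open>j div m\<close> only, the form
    to which \<open>cong_sum_blocks\<close> applies.\<close>
  have f: "?P j (Suc k) = ?f (j div m)" for j
    by (rule part_count_power_seq_Suc[OF assms])
  have "?P n (Suc (Suc k)) = (\<Sum>j\<le>n div m. ?f (j div m))"
    unfolding part_count_power_seq_Suc[OF assms, of n "Suc k"] f ..
  also have "[\<dots> = (n div m mod m + 1) * ?P (n div m) (Suc k)] (mod m)"
    unfolding f by (rule cong_sum_blocks[OF assms])
  also have "[(n div m mod m + 1) * ?P (n div m) (Suc k)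
      = (n div m mod m + 1) * (\<Prod>j=1..k. n div m div m ^ j mod m + 1)] (mod m)"
    by (intro cong_mult cong_refl Suc.IH)
  \<comment> \<open>Digit \<open>j\<close> of \<open>n div m\<close> is digit \<open>j + 1\<close>
    of \<open>n\<close>.\<close>
  also have "(n div m mod m + 1) * (\<Prod>j=1..k. n div m div m ^ j mod m + 1)
      = (\<Prod>j=1..Suc k. n div m ^ j mod m + 1)"
  proof -
    have "(\<Prod>j=1..Suc k. n div m ^ j mod m + 1)
        = (n div m mod m + 1) * (\<Prod>j=Suc 1..Suc k. n div m ^ j mod m + 1)"
      by (subst prod.atLeast_Suc_atMost) auto
    also have "(\<Prod>j=Suc 1..Suc k. n div m ^ j mod m + 1)
        = (\<Prod>j=1..k. n div m ^ Suc j mod m + 1)"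
      by (rule prod.shift_bounds_cl_Suc_ivl)
    finally show ?thesis by (simp add: div_mult2_eq)
  qed
  finally show ?case .
qed

lemma sum_digits_Suc:
  fixes m :: nat
  shows "(\<Sum>i<Suc N. c i * m ^ i) = c 0 + m * (\<Sum>i<N. c (Suc i) * m ^ i)"
  by (simp add: sum.lessThan_Suc_shift sum_distrib_left mult.left_commute del: sum.lessThan_Suc)

text \<open>Division by \<open>m\<close> drops \<open>c 0\<close>, which is less than
  \<open>m\<close>, and shifts the digits; hence the induction on \<open>j\<close> with
  \<open>c\<close> and \<open>N\<close> arbitrary.\<close>

lemma digit_of_sum:
  fixes m :: nat
  assumes "\<And>j. c j < m" and "j < N"
  shows "(\<Sum>i<N. c i * m ^ i) div m ^ j mod m = c j"
  using assms
proof (induction j arbitrary: c N)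
  case (0 c N)
  then obtain N' where "N = Suc N'" by (cases N) auto
  with 0 show ?case
    by (simp add: sum_digits_Suc del: sum.lessThan_Suc)
next
  case (Suc j c N)
  then obtain N' where N: "N = Suc N'" and j: "j < N'" by (cases N) auto
  have "(\<Sum>i<N. c i * m ^ i) = c 0 + m * (\<Sum>i<N'. c (Suc i) * m ^ i)"
    unfolding N by (rule sum_digits_Suc)
  then have "(\<Sum>i<N. c i * m ^ i) div m = (\<Sum>i<N'. c (Suc i) * m ^ i)"
    using Suc.prems(1)[of 0] by simp
  then show ?case
    using Suc.IH[of "\<lambda>i. c (Suc i)" N'] Suc.prems(1) j by (simp add: div_mult2_eq)
qed

theorem theorem6p2:
  fixes m k n :: nat and c :: "nat \<Rightarrow> nat"
  assumes "m > 1" and "k > 0" and "n > 0"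
    and "\<And>j. c j \<in> {0..m - 1}"
    and "finite {j. c j \<noteq> 0}"
    and "n = (\<Sum>j | c j \<noteq> 0. c j * m ^ j)"
  shows "[part_count (power_seq m) n k = (\<Prod>j=1..k - 1. c j + 1)] (mod m)"
proof -
  have less: "c j < m" for j using assms(1) assms(4)[of j] by auto
  have digit: "n div m ^ j mod m = c j" for j
  proof -
    obtain M where M: "\<forall>i\<in>{j. c j \<noteq> 0}. i < M"
      using assms(5) finite_nat_set_iff_bounded by blast
    \<comment> \<open>The support is padded with zero digits to an initial segment;
      \<open>Suc j\<close> ensures that it contains \<open>j\<close> even beyond the
      support.\<close>
    have "n = (\<Sum>i<max M (Suc j). c i * m ^ i)"
      unfolding assms(6) using M by (intro sum.mono_neutral_left) (auto simp: less_max_iff_disj)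
    then show ?thesis using digit_of_sum[of c m j "max M (Suc j)"] less by simp
  qed
  from part_count_power_seq_cong[of m n "k - 1"] show ?thesis
    using assms(1,2) by (simp add: digit)
qed

end
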